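(* Let $n\in\mathbb{N}$, let $R$ be an $n$-simple Bézout domain, and let $m\ge n$ be an integer. Then for each $A\in R^{m\times m}$ there exist $P,Q\in GL_m(R)$ such that $$PAQ=\begin{pmatrix}E&0&0\\0&T&0\\0&0&0\end{pmatrix},$$ where $E$ is an identity matrix, $T=\operatorname{diag}(A_1,\ldots,A_k)$ is block diagonal, and each $A_i\in R^{n\times n}$ is a triangular matrix. (Any of the diagonal blocks $E$, $T$, $0$ may be of size zero.)
   Context: Rings are associative (not necessarily commutative) with nonzero unit; $\mathbb{N}$ is the set of positive integers. $R^{r\times s}$ denotes the set of $r\times s$ matrices over $R$, and $GL_m(R)$ is the group of units of $R^{m\times m}$. A ring is a right (left) Bézout ring if each of its finitely generated right (left) ideals is principal, and a Bézout ring if it is both right and left Bézout. A Bézout domain is a domain that is a Bézout ring. A ring $R$ is simple if it has no two-sided ideals other than $0$ and $R$. A simple ring $R$ is called $n$-simple if $n$ is the minimal positive integer such that for every $a\in R\setminus\{0\}$ there exist $u_1,\ldots,u_n,v_1,\ldots,v_n\in R$ with $u_1av_1+\cdots+u_nav_n=1$. A triangular matrix is a square matrix that is upper triangular or lower triangular. *)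

theory Defs
  imports "Jordan_Normal_Form.Matrix"
begin

text \<open>A ring is a type of class \<^class>\<open>ring_1\<close> (associative, not necessarily commutative,
  with \<open>0 \<noteq> 1\<close>); a domain is a type of class \<^class>\<open>ring_1_no_zero_divisors\<close>.\<close>

text \<open>Closure of one-sided ideals under negation follows from multiplication by \<open>- 1\<close>.\<close>

definition left_ideal :: "'a::ring_1 set \<Rightarrow> bool" where
  "left_ideal I \<longleftrightarrow> 0 \<in> I \<and> (\<forall>a\<in>I. \<forall>b\<in>I. a + b \<in> I) \<and> (\<forall>r. \<forall>a\<in>I. r * a \<in> I)"

definition right_ideal :: "'a::ring_1 set \<Rightarrow> bool" where
  "right_ideal I \<longleftrightarrow> 0 \<in> I \<and> (\<forall>a\<in>I. \<forall>b\<in>I. a + b \<in> I) \<and> (\<forall>r. \<forall>a\<in>I. a * r \<in> I)"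

definition two_sided_ideal :: "'a::ring_1 set \<Rightarrow> bool" where
  "two_sided_ideal I \<longleftrightarrow> left_ideal I \<and> right_ideal I"

text \<open>\<open>left_ideal hull S\<close> and \<open>right_ideal hull S\<close> are the one-sided ideals generated by \<open>S\<close>.\<close>

definition left_bezout_ring :: "'a::ring_1 itself \<Rightarrow> bool" where
  "left_bezout_ring _ \<longleftrightarrow>
     (\<forall>S :: 'a set. finite S \<longrightarrow> (\<exists>d. left_ideal hull S = left_ideal hull {d}))"

definition right_bezout_ring :: "'a::ring_1 itself \<Rightarrow> bool" where
  "right_bezout_ring _ \<longleftrightarrow>
     (\<forall>S :: 'a set. finite S \<longrightarrow> (\<exists>d. right_ideal hull S = right_ideal hull {d}))"

definition bezout_ring :: "'a::ring_1 itself \<Rightarrow> bool" where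
  "bezout_ring R \<longleftrightarrow> left_bezout_ring R \<and> right_bezout_ring R"

definition bezout_domain :: "'a::ring_1_no_zero_divisors itself \<Rightarrow> bool" where
  "bezout_domain R \<longleftrightarrow> bezout_ring R"

definition simple_ring :: "'a::ring_1 itself \<Rightarrow> bool" where
  "simple_ring _ \<longleftrightarrow> (\<forall>I :: 'a set. two_sided_ideal I \<longrightarrow> I = {0} \<or> I = UNIV)"

definition one_as_sum :: "'a::ring_1 itself \<Rightarrow> nat \<Rightarrow> bool" where
  "one_as_sum _ k \<longleftrightarrow>
     (\<forall>a :: 'a. a \<noteq> 0 \<longrightarrow> (\<exists>u v :: nat \<Rightarrow> 'a. (\<Sum>i<k. u i * a * v i) = 1))"

definition n_simple_ring :: "'a::ring_1 itself \<Rightarrow> nat \<Rightarrow> bool" where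
  "n_simple_ring R n \<longleftrightarrow>
     simple_ring R \<and> 0 < n \<and> one_as_sum R n \<and> (\<forall>k. 0 < k \<and> one_as_sum R k \<longrightarrow> n \<le> k)"

definition lower_triangular :: "'a::zero mat \<Rightarrow> bool" where
  "lower_triangular A \<longleftrightarrow> (\<forall>j < dim_col A. \<forall>i < j. A $$ (i, j) = 0)"

definition triangular :: "'a::zero mat \<Rightarrow> bool" where
  "triangular A \<longleftrightarrow> square_mat A \<and> (upper_triangular A \<or> lower_triangular A)"

definition GL :: "nat \<Rightarrow> 'a::ring_1 mat set" where
  "GL m = {P \<in> carrier_mat m m. invertible_mat P}"

end

theory Submission
  imports Defs
begin

text \<open>
  A single triangular block always suffices: every \<open>A\<close> is equivalent to
  \<open>diag(1, \<dots>, 1, T, 0, \<dots>, 0)\<close> with \<open>T\<close> lower triangular of size \<open>n\<close>. The size \<open>m\<close> is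
  lowered one step at a time until it reaches \<open>n\<close>, where column operations make the
  matrix triangular (\<open>lower_triangularization\<close>).

  For \<open>m > n\<close> there are two cases. If \<open>u A = 0\<close> for some row \<open>u \<noteq> 0\<close>, then a change of basis
  turns \<open>u\<close> into a multiple of the last basis row, so the last row of \<open>A\<close> becomes zero; making
  the result lower triangular kills the last column as well, and \<open>A\<close> is equivalent to
  \<open>diag(A', 0)\<close> (\<open>left_kernel_imp_zero_summand\<close>). Otherwise \<open>A\<close> is regular on the left. The
  left Ore condition then provides \<open>Y\<close> and a scalar \<open>d \<noteq> 0\<close> with \<open>Y A = d I\<close>, a common
  denominator for the inverse of \<open>A\<close> over the division ring of fractions. An identity
  \<open>u\<^sub>1 d v\<^sub>1 + \<dots> + u\<^sub>n d v\<^sub>n = 1\<close> involves \<open>n \<le> m\<close> coordinates, so it reads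
  \<open>(u Y) A v = 1\<close> (\<open>unit_value_of_left_regular\<close>). A row and a column between which \<open>A\<close> takes the
  value \<open>1\<close> can both be completed to bases, which splits off an entry \<open>1\<close>:
  \<open>A\<close> is equivalent to \<open>diag(1, A')\<close> (\<open>unit_value_imp_one_summand\<close>).

  The two Bezout conditions have separate tasks. The right-hand one makes rows reducible to a
  single entry by invertible column operations, through \<open>unimodular_pair_completion\<close>. The
  left-hand one enters through the left Ore condition, by which more rows than columns always
  satisfy a nontrivial linear relation (\<open>left_dependence\<close>).
\<close>

section \<open>One-sided ideals of a Bezout domain\<close>

lemma right_ideal_hull_singleton:
  fixes d :: "'a::ring_1"
  shows "right_ideal hull {d} = {d * r | r. True}"
proof (rule hull_unique)
  show "{d} \<subseteq> {d * r | r. True}" by (auto intro: exI[of _ 1])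
  show "right_ideal {d * r | r. True}"
    unfolding right_ideal_def by (force simp: mult.assoc simp flip: distrib_left intro: exI[of _ 0])
qed (auto simp: right_ideal_def)

lemma right_ideal_hull_pair:
  fixes a b :: "'a::ring_1"
  shows "right_ideal hull {a, b} = {a * r + b * s | r s. True}"
proof (rule hull_unique)
  have "a = a * 1 + b * 0" "b = a * 0 + b * 1" by simp_all
  then show "{a, b} \<subseteq> {a * r + b * s | r s. True}" by blast
  show "right_ideal {a * r + b * s | r s. True}" (is "right_ideal ?I")
    unfolding right_ideal_def
  proof (intro conjI ballI allI)
    have "0 = a * 0 + b * 0" by simp
    then show "0 \<in> ?I" by blast
  next
    fix x y assume "x \<in> ?I" "y \<in> ?I"
    then obtain r s r' s' where "x = a * r + b * s" "y = a * r' + b * s'" by blast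
    then have "x + y = a * (r + r') + b * (s + s')" by (simp add: algebra_simps)
    then show "x + y \<in> ?I" by blast
  next
    fix t x assume "x \<in> ?I"
    then obtain r s where "x = a * r + b * s" by blast
    then have "x * t = a * (r * t) + b * (s * t)" by (simp add: algebra_simps)
    then show "x * t \<in> ?I" by blast
  qed
qed (auto simp: right_ideal_def)

lemma left_ideal_hull_singleton:
  fixes d :: "'a::ring_1"
  shows "left_ideal hull {d} = {r * d | r. True}"
proof (rule hull_unique)
  show "{d} \<subseteq> {r * d | r. True}" by (auto intro: exI[of _ 1])
  show "left_ideal {r * d | r. True}"
    unfolding left_ideal_def
    by (force simp flip: mult.assoc simp flip: distrib_right intro: exI[of _ 0])
qed (auto simp: left_ideal_def)

lemma left_ideal_hull_pair:
  fixes a b :: "'a::ring_1"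
  shows "left_ideal hull {a, b} = {r * a + s * b | r s. True}"
proof (rule hull_unique)
  have "a = 1 * a + 0 * b" "b = 0 * a + 1 * b" by simp_all
  then show "{a, b} \<subseteq> {r * a + s * b | r s. True}" by blast
  show "left_ideal {r * a + s * b | r s. True}" (is "left_ideal ?I")
    unfolding left_ideal_def
  proof (intro conjI ballI allI)
    have "0 = 0 * a + 0 * b" by simp
    then show "0 \<in> ?I" by blast
  next
    fix x y assume "x \<in> ?I" "y \<in> ?I"
    then obtain r s r' s' where "x = r * a + s * b" "y = r' * a + s' * b" by blast
    then have "x + y = (r + r') * a + (s + s') * b" by (simp add: algebra_simps)
    then show "x + y \<in> ?I" by blast
  next
    fix t x assume "x \<in> ?I"
    then obtain r s where "x = r * a + s * b" by blast
    then have "t * x = (t * r) * a + (t * s) * b" by (simp add: algebra_simps)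
    then show "t * x \<in> ?I" by blast
  qed
qed (auto simp: left_ideal_def)

lemma right_bezout_gcd:
  fixes a b :: "'a::ring_1"
  assumes "right_bezout_ring TYPE('a)"
  obtains d x y p q where "a = d * p" "b = d * q" "d = a * x + b * y"
proof -
  obtain d where "right_ideal hull {a, b} = right_ideal hull {d}"
    using assms unfolding right_bezout_ring_def by (metis finite.emptyI finite.insertI)
  then have eq: "{a * r + b * s | r s. True} = {d * r | r. True}"
    by (simp add: right_ideal_hull_singleton right_ideal_hull_pair)
  have "a = a * 1 + b * 0" "b = a * 0 + b * 1" "d = d * 1" by simp_all
  then have "a \<in> {d * r | r. True}" "b \<in> {d * r | r. True}"
    "d \<in> {a * r + b * s | r s. True}"
    using eq by blast+
  then show ?thesis using that by blast
qed

lemma left_bezout_gcd: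
  fixes a b :: "'a::ring_1"
  assumes "left_bezout_ring TYPE('a)"
  obtains d x y p q where "a = p * d" "b = q * d" "d = x * a + y * b"
proof -
  obtain d where "left_ideal hull {a, b} = left_ideal hull {d}"
    using assms unfolding left_bezout_ring_def by (metis finite.emptyI finite.insertI)
  then have eq: "{r * a + s * b | r s. True} = {r * d | r. True}"
    by (simp add: left_ideal_hull_singleton left_ideal_hull_pair)
  have "a = 1 * a + 0 * b" "b = 0 * a + 1 * b" "d = 1 * d" by simp_all
  then have "a \<in> {r * d | r. True}" "b \<in> {r * d | r. True}"
    "d \<in> {r * a + s * b | r s. True}"
    using eq by blast+
  then show ?thesis using that by blast
qed

lemma right_inverse_imp_left_inverse:
  fixes a b :: "'a::ring_1_no_zero_divisors"
  assumes "a * b = 1" shows "b * a = 1"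
proof -
  have "a * (b * a) = a * 1" by (simp add: assms flip: mult.assoc)
  moreover have "a \<noteq> 0" using assms by auto
  ultimately show ?thesis using mult_left_cancel by blast
qed

section \<open>The left Ore condition and linear dependence\<close>

text \<open>After division by the common right divisor \<open>d\<close> one has \<open>x p + y q = 1\<close>. Multiplying this relation by \<open>p\<close>
  or by \<open>q\<close> from the left gives two linear relations between \<open>p\<close> and \<open>q\<close>. They cannot both
  be trivial: the first one, \<open>(1 - p x) p = (p y) q\<close>, is trivial only if \<open>y = 0\<close>, and then the
  second one is \<open>(q x) p = q\<close>.\<close>

lemma left_Ore:
  fixes a b :: "'a::ring_1_no_zero_divisors"
  assumes bez: "left_bezout_ring TYPE('a)" and "a \<noteq> 0" "b \<noteq> 0"
  obtains s t where "s \<noteq> 0" "t \<noteq> 0" "s * a = t * b"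
proof -
  obtain d x y p q where d: "a = p * d" "b = q * d" "d = x * a + y * b"
    by (rule left_bezout_gcd[OF bez, of a b])
  have "d \<noteq> 0" using d(1) \<open>a \<noteq> 0\<close> by auto
  have "(x * p + y * q) * d = x * a + y * b" unfolding d(1,2) by (simp add: algebra_simps)
  then have "(x * p + y * q) * d = 1 * d" by (simp flip: d(3))
  then have one: "x * p + y * q = 1" using \<open>d \<noteq> 0\<close> mult_right_cancel by blast
  have "p \<noteq> 0" "q \<noteq> 0" using d(1,2) \<open>a \<noteq> 0\<close> \<open>b \<noteq> 0\<close> by auto
  have nz: "s \<noteq> 0 \<longleftrightarrow> t \<noteq> 0" if "s * p = t * q" for s t
    using arg_cong[OF that, of "\<lambda>z. z = 0"] \<open>p \<noteq> 0\<close> \<open>q \<noteq> 0\<close> by simp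
  have rel: "s * a = t * b" if "s * p = t * q" for s t
    using that unfolding d(1,2) by (simp flip: mult.assoc)
  show ?thesis
  proof (cases "y = 0")
    case True
    have *: "(q * x) * p = 1 * q" using one True
      by (simp add: mult.assoc)
    show ?thesis using that[of "q * x" 1] nz[OF *] rel[OF *] by simp
  next
    case False
    have "(1 - p * x) * p = p * (1 - x * p)" by (simp add: algebra_simps)
    also have "1 - x * p = y * q" using one by (simp add: algebra_simps)
    finally have *: "(1 - p * x) * p = (p * y) * q" by (simp add: mult.assoc)
    show ?thesis using that[of "1 - p * x" "p * y"] nz[OF *] rel[OF *] False \<open>p \<noteq> 0\<close> by simp
  qed
qed

lemma common_left_multiple:
  fixes t :: "'i \<Rightarrow> 'a::ring_1_no_zero_divisors"
  assumes bez: "left_bezout_ring TYPE('a)" and "finite K" "\<And>k. k \<in> K \<Longrightarrow> t k \<noteq> 0"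
  shows "\<exists>d c. d \<noteq> 0 \<and> (\<forall>k\<in>K. d = c k * t k)"
  using assms(2,3)
proof (induction K rule: finite_induct)
  case empty
  show ?case by (auto intro: exI[of _ 1])
next
  case (insert k K)
  then obtain d c where d: "d \<noteq> 0" "\<forall>k\<in>K. d = c k * t k" by auto
  have "t k \<noteq> 0" using insert.prems by simp
  then obtain s r where sr: "s \<noteq> 0" "r \<noteq> 0" "s * d = r * t k"
    by (rule left_Ore[OF bez d(1)])
  have "s * d = (if i = k then r else s * c i) * t i" if "i \<in> insert k K" for i
  proof (cases "i = k")
    case False
    then have "d = c i * t i" using that d(2) by blast
    then show ?thesis using False by (simp add: mult.assoc)
  qed (simp add: sr(3))
  then have "\<forall>i\<in>insert k K. s * d = (if i = k then r else s * c i) * t i" by blast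
  moreover have "s * d \<noteq> 0" using sr(1) d(1) by simp
  ultimately show ?case
    by (intro exI[of _ "s * d"] exI[of _ "\<lambda>i. if i = k then r else s * c i"] conjI)
qed

text \<open>Gaussian elimination without division: the left Ore condition allows an entry to be
  cleared after multiplying its row by a nonzero scalar, so more rows than columns force a
  nontrivial relation, as over a field.\<close>

lemma left_dependence:
  fixes f :: "'i \<Rightarrow> 'j \<Rightarrow> 'a::ring_1_no_zero_divisors"
  assumes bez: "left_bezout_ring TYPE('a)"
    and "finite J" "finite I" "card J < card I"
  shows "\<exists>u. (\<exists>i\<in>I. u i \<noteq> 0) \<and> (\<forall>j\<in>J. (\<Sum>i\<in>I. u i * f i j) = 0)"
  using assms(2-)
proof (induction J arbitrary: I f rule: finite_induct)
  case empty
  then have "I \<noteq> {}" by auto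
  then show ?case by (intro exI[of _ "\<lambda>_. 1"]) auto
next
  case (insert l J)
  show ?case
  proof (cases "\<forall>i\<in>I. f i l = 0")
    case True
    have "card J < card I" using insert by simp
    then obtain u where "\<exists>i\<in>I. u i \<noteq> 0" "\<forall>j\<in>J. (\<Sum>i\<in>I. u i * f i j) = 0"
      using insert.IH[OF insert.prems(1), of f] by auto
    then show ?thesis using True by (intro exI[of _ u]) auto
  next
    case False
    then obtain p where p: "p \<in> I" "f p l \<noteq> 0" by auto
    have "\<exists>s t. s \<noteq> 0 \<and> s * f i l = t * f p l" for i
    proof (cases "f i l = 0")
      case True
      then show ?thesis by (intro exI[of _ 1] exI[of _ 0]) auto
    next
      case False
      show ?thesis by (rule left_Ore[OF bez False p(2)]) blast
    qed
    then obtain s t where st: "\<And>i. s i \<noteq> 0" "\<And>i. s i * f i l = t i * f p l" by metis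
    have "card J < card (I - {p})" using insert p by simp
    then obtain u where u: "\<exists>i\<in>I-{p}. u i \<noteq> 0"
      "\<forall>j\<in>J. (\<Sum>i\<in>I-{p}. u i * (s i * f i j - t i * f p j)) = 0"
      using insert.IH[of "I - {p}" "\<lambda>i j. s i * f i j - t i * f p j"] insert.prems by auto
    \<comment> \<open>The relation between the rows \<open>s i * f i - t i * f p\<close>, rewritten for the rows \<open>f i\<close>.\<close>
    define w where "w = (\<lambda>i. if i = p then - (\<Sum>i\<in>I-{p}. u i * t i) else u i * s i)"
    have w: "(\<Sum>i\<in>I. w i * f i j) = (\<Sum>i\<in>I-{p}. u i * (s i * f i j - t i * f p j))" for j
    proof -
      have "(\<Sum>i\<in>I. w i * f i j) = w p * f p j + (\<Sum>i\<in>I-{p}. w i * f i j)"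
        using sum.remove[OF insert.prems(1) p(1)] by blast
      also have "(\<Sum>i\<in>I-{p}. w i * f i j) = (\<Sum>i\<in>I-{p}. u i * (s i * f i j))"
        by (rule sum.cong) (auto simp: w_def mult.assoc)
      also have "w p * f p j = - (\<Sum>i\<in>I-{p}. u i * (t i * f p j))"
        by (simp add: w_def sum_distrib_right mult.assoc)
      finally show ?thesis by (simp add: right_diff_distrib sum_subtractf)
    qed
    have "\<forall>j\<in>insert l J. (\<Sum>i\<in>I. w i * f i j) = 0"
      using u(2) unfolding w by (auto simp: st(2))
    moreover have "\<exists>i\<in>I. w i \<noteq> 0" using u(1) st(1) by (auto simp: w_def)
    ultimately show ?thesis by blast
  qed
qed

section \<open>Completing unimodular pairs\<close>

text \<open>The row \<open>(p, q)\<close> and the column \<open>(x, y)\<close> are completed to two mutually inverse matrices.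
  The kernel of \<open>(p, q)\<close> is generated by the columns \<open>(1 - x p, - y p)\<close> and \<open>(- x q, 1 - y q)\<close>
  of the projection along \<open>(x, y)\<close>. If \<open>q \<noteq> 0\<close>, an element of this kernel is determined by its
  first coordinate, so the kernel is isomorphic to a finitely generated right ideal, hence
  to a principal one; it is therefore free on one generator \<open>(g, h)\<close>, and \<open>r\<close> and \<open>s\<close> are
  the coordinates of the two columns.\<close>

lemma unimodular_pair_completion:
  fixes p q x y :: "'a::ring_1_no_zero_divisors"
  assumes bez: "right_bezout_ring TYPE('a)" and one: "p * x + q * y = 1"
  obtains g h r s where
    "p * g + q * h = 0" "r * x + s * y = 0" "r * g + s * h = 1"
    "x * p + g * r = 1" "x * q + g * s = 0" "y * p + h * r = 0" "y * q + h * s = 1"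
proof (cases "q = 0")
  case True
  then have px: "p * x = 1" using one by simp
  then have xp: "x * p = 1" by (rule right_inverse_imp_left_inverse)
  show ?thesis
    by (rule that[of 0 1 "- (y * p)" 1]) (simp_all add: True xp px mult.assoc)
next
  case False
  obtain g \<alpha> \<beta> r s where g: "1 - x * p = g * r" "- (x * q) = g * s"
      "g = (1 - x * p) * \<alpha> + (- (x * q)) * \<beta>"
    by (rule right_bezout_gcd[OF bez, of "1 - x * p" "- (x * q)"])
  define h where "h = (- (y * p)) * \<alpha> + (1 - y * q) * \<beta>"
  have qy: "q * y = 1 - p * x" using one by (simp add: algebra_simps)
  have "p * (1 - x * p) - q * (y * p) = 0" "- (p * (x * q)) + q * (1 - y * q) = 0"
  proof -
    have "p * (1 - x * p) - q * (y * p) = p - (p * x + q * y) * p" by (simp add: algebra_simps)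
    then show "p * (1 - x * p) - q * (y * p) = 0" by (simp add: one)
    have "- (p * (x * q)) + q * (1 - y * q) = q - (p * x + q * y) * q" by (simp add: algebra_simps)
    then show "- (p * (x * q)) + q * (1 - y * q) = 0" by (simp add: one)
  qed
  moreover have "p * g + q * h
      = (p * (1 - x * p) - q * (y * p)) * \<alpha> + (- (p * (x * q)) + q * (1 - y * q)) * \<beta>"
    unfolding h_def by (subst g(3)) (simp add: algebra_simps)
  ultimately have pg: "p * g + q * h = 0" by simp
  then have qh: "q * h = - (p * g)" by (simp add: eq_neg_iff_add_eq_0 add.commute)
  have "q * (h * r) = q * (- (y * p))"
  proof -
    have "q * (h * r) = - (p * (g * r))" by (simp add: qh flip: mult.assoc)
    also have "\<dots> = - ((1 - p * x) * p)" by (simp add: algebra_simps flip: g(1))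
    also have "\<dots> = q * (- (y * p))" by (simp add: mult.assoc flip: qy)
    finally show ?thesis .
  qed
  then have hr: "h * r = - (y * p)" using False mult_left_cancel by blast
  have "q * (h * s) = q * (1 - y * q)"
  proof -
    have "q * (h * s) = - (p * (g * s))" by (simp add: qh flip: mult.assoc)
    also have "\<dots> = p * (x * q)" by (simp flip: g(2))
    also have "\<dots> = (1 - q * y) * q" by (simp add: qy mult.assoc)
    also have "\<dots> = q * (1 - y * q)" by (simp add: algebra_simps)
    finally show ?thesis .
  qed
  then have hs: "h * s = 1 - y * q" using False mult_left_cancel by blast
  have "g \<noteq> 0"
  proof
    assume "g = 0"
    then have "x * p = 1" "x * q = 0" using g(1,2) by auto
    then show False using False by auto
  qed
  have "g * (r * x + s * y) = g * r * x + g * s * y" by (simp add: algebra_simps)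
  also have "\<dots> = (1 - x * p) * x - x * q * y" by (simp flip: g(1,2))
  also have "\<dots> = x - x * (p * x + q * y)" by (simp add: algebra_simps)
  finally have "g * (r * x + s * y) = g * 0" by (simp add: one)
  then have rx: "r * x + s * y = 0" using \<open>g \<noteq> 0\<close> mult_left_cancel by blast
  have "g * (r * g + s * h) = g * r * g + g * s * h" by (simp add: algebra_simps)
  also have "\<dots> = (1 - x * p) * g - x * q * h" by (simp flip: g(1,2))
  also have "\<dots> = g - x * (p * g + q * h)" by (simp add: algebra_simps)
  finally have "g * (r * g + s * h) = g * 1" by (simp add: pg)
  then have rg: "r * g + s * h = 1" using \<open>g \<noteq> 0\<close> mult_left_cancel by blast
  show ?thesis
    by (rule that[of g h r s]) (simp_all add: pg rx rg hr hs flip: g(1,2))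
qed

section \<open>The general linear group and column operations\<close>

lemma GL_iff:
  "P \<in> GL m \<longleftrightarrow> P \<in> carrier_mat m m \<and> (\<exists>P'\<in>carrier_mat m m. P * P' = 1\<^sub>m m \<and> P' * P = 1\<^sub>m m)"
  (is "?L \<longleftrightarrow> ?R")
proof
  assume ?L
  then obtain P' where P: "P \<in> carrier_mat m m" "P * P' = 1\<^sub>m m" "P' * P = 1\<^sub>m (dim_row P')"
    by (auto simp: GL_def invertible_mat_def inverts_mat_def)
  have "dim_col P' = m" using arg_cong[OF P(2), of dim_col] by simp
  moreover have "dim_row P' = m" using arg_cong[OF P(3), of dim_col] P(1) by simp
  ultimately show ?R using P by (intro conjI bexI[of _ P']) auto
next
  assume ?R
  then obtain P' where "P \<in> carrier_mat m m" "P' \<in> carrier_mat m m" "P * P' = 1\<^sub>m m" "P' * P = 1\<^sub>m m"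
    by blast
  then show ?L unfolding GL_def invertible_mat_def inverts_mat_def
    by (intro CollectI conjI exI[of _ P']) auto
qed

lemma GL_carrier: "P \<in> GL m \<Longrightarrow> P \<in> carrier_mat m m"
  by (simp add: GL_iff)

lemma GL_inverse:
  assumes "P \<in> GL m"
  obtains P' where "P' \<in> GL m" "P * P' = 1\<^sub>m m" "P' * P = 1\<^sub>m m"
proof -
  obtain P' where "P \<in> carrier_mat m m" "P' \<in> carrier_mat m m" "P * P' = 1\<^sub>m m" "P' * P = 1\<^sub>m m"
    using assms unfolding GL_iff by blast
  moreover from this have "P' \<in> GL m" unfolding GL_iff by blast
  ultimately show ?thesis using that by blast
qed

lemma one_GL: "1\<^sub>m m \<in> GL m"
  unfolding GL_iff by (auto intro!: bexI[of _ "1\<^sub>m m"])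

lemma GL_mult:
  assumes "P \<in> GL m" "Q \<in> GL m"
  shows "P * Q \<in> GL m"
proof -
  obtain P' Q' where inv: "P' \<in> GL m" "P * P' = 1\<^sub>m m" "P' * P = 1\<^sub>m m"
      "Q' \<in> GL m" "Q * Q' = 1\<^sub>m m" "Q' * Q = 1\<^sub>m m"
    using GL_inverse assms by metis
  note c = GL_carrier[OF assms(1)] GL_carrier[OF assms(2)] GL_carrier[OF inv(1)] GL_carrier[OF inv(4)]
  have "P * Q * (Q' * P') = P * (Q * Q' * P')" using c by (simp add: assoc_mult_mat[of _ m m _ m _ m])
  then have 1: "P * Q * (Q' * P') = 1\<^sub>m m" using inv c by simp
  have "Q' * P' * (P * Q) = Q' * (P' * P * Q)" using c by (simp add: assoc_mult_mat[of _ m m _ m _ m])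
  then have 2: "Q' * P' * (P * Q) = 1\<^sub>m m" using inv c by simp
  show ?thesis unfolding GL_iff
    using 1 2 c by (intro conjI bexI[of _ "Q' * P'"]) (auto simp del: assoc_mult_mat)
qed

lemma index_mult_mat_sum:
  assumes "A \<in> carrier_mat nr k" "B \<in> carrier_mat k nc" "i < nr" "j < nc"
  shows "(A * B) $$ (i, j) = (\<Sum>l<k. A $$ (i, l) * B $$ (l, j))"
  using assms by (auto simp: scalar_prod_def atLeast0LessThan)

text \<open>The identity matrix with the block \<open>a, b; c, d\<close> in the rows and columns \<open>i\<close> and \<open>j\<close>.\<close>

definition plane_mat :: "nat \<Rightarrow> nat \<Rightarrow> nat \<Rightarrow> 'a \<Rightarrow> 'a \<Rightarrow> 'a \<Rightarrow> 'a \<Rightarrow> 'a::ring_1 mat" where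
  "plane_mat m i j a b c d = mat m m (\<lambda>(k, l).
     if l = i then (if k = i then a else if k = j then c else 0)
     else if l = j then (if k = i then b else if k = j then d else 0)
     else if k = l then 1 else 0)"

lemma plane_mat_carrier [simp]: "plane_mat m i j a b c d \<in> carrier_mat m m"
  by (simp add: plane_mat_def)

lemma index_mult_plane_mat:
  assumes A: "A \<in> carrier_mat nr m" and "k < nr" "l < m" "i < m" "j < m" "i \<noteq> j"
  shows "(A * plane_mat m i j a b c d) $$ (k, l) =
    (if l = i then A $$ (k, i) * a + A $$ (k, j) * c
     else if l = j then A $$ (k, i) * b + A $$ (k, j) * d else A $$ (k, l))"
proof -
  have *: "(\<Sum>t<m. A $$ (k, t) * (if t = i then e else if t = j then f else 0))
      = A $$ (k, i) * e + A $$ (k, j) * f" for e f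
  proof -
    have "(\<Sum>t<m. A $$ (k, t) * (if t = i then e else if t = j then f else 0))
      = (\<Sum>t\<in>{i, j}. A $$ (k, t) * (if t = i then e else if t = j then f else 0))"
      using assms by (intro sum.mono_neutral_right) auto
    then show ?thesis using assms by auto
  qed
  have "(A * plane_mat m i j a b c d) $$ (k, l) = (\<Sum>t<m. A $$ (k, t) *
     (if l = i then (if t = i then a else if t = j then c else 0)
     else if l = j then (if t = i then b else if t = j then d else 0)
     else if t = l then 1 else 0))"
    using assms by (subst index_mult_mat_sum[OF A plane_mat_carrier]) (auto simp: plane_mat_def)
  moreover have "(\<Sum>t<m. A $$ (k, t) * (if t = l then 1 else 0)) = A $$ (k, l)"
    using assms by (simp add: if_distrib[of "\<lambda>z. _ * z"] cong: if_cong)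
  ultimately show ?thesis by (simp add: * split del: if_split cong: if_cong) (simp add: *)
qed

lemma plane_mat_GL:
  fixes p q r s x y g h :: "'a::ring_1"
  assumes "i < m" "j < m" "i \<noteq> j"
    and "p * x + q * y = 1" "p * g + q * h = 0" "r * x + s * y = 0" "r * g + s * h = 1"
    and "x * p + g * r = 1" "x * q + g * s = 0" "y * p + h * r = 0" "y * q + h * s = 1"
  shows "plane_mat m i j x g y h \<in> GL m"
  unfolding GL_iff
proof (intro conjI bexI)
  show "plane_mat m i j x g y h * plane_mat m i j p q r s = 1\<^sub>m m"
    by (rule eq_matI, use assms in \<open>auto simp: index_mult_plane_mat[of _ m]
      simp del: index_mult_mat(1)\<close>) (auto simp: plane_mat_def assms assms(3)[symmetric])
  show "plane_mat m i j p q r s * plane_mat m i j x g y h = 1\<^sub>m m"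
    by (rule eq_matI, use assms in \<open>auto simp: index_mult_plane_mat[of _ m]
      simp del: index_mult_mat(1)\<close>) (auto simp: plane_mat_def assms assms(3)[symmetric])
qed auto

text \<open>Each entry of row \<open>i\<close> in \<open>S\<close> is cleared against the entry at \<open>p\<close> by one plane
  transformation. The last two clauses record that only the columns in \<open>insert p S\<close> are
  combined with each other; because of them, zeros produced earlier in other rows survive
  when the reduction is repeated row by row.\<close>

lemma row_reduction:
  fixes A :: "'a::ring_1_no_zero_divisors mat"
  assumes bez: "right_bezout_ring TYPE('a)"
    and A: "A \<in> carrier_mat nr m" and "i < nr" "p < m"
    and "finite S" "S \<subseteq> {..<m}" "p \<notin> S"
  shows "\<exists>Q\<in>GL m. (\<forall>j\<in>S. (A * Q) $$ (i, j) = 0) \<and>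
    (\<forall>k<nr. \<forall>j<m. j \<notin> insert p S \<longrightarrow> (A * Q) $$ (k, j) = A $$ (k, j)) \<and>
    (\<forall>k<nr. (\<forall>j\<in>insert p S. A $$ (k, j) = 0) \<longrightarrow> (\<forall>j\<in>insert p S. (A * Q) $$ (k, j) = 0))"
  using assms(5-)
proof (induction S rule: finite_induct)
  case empty
  show ?case using A by (intro bexI[of _ "1\<^sub>m m"] one_GL) auto
next
  case (insert l S)
  then obtain Q where Q: "Q \<in> GL m" "\<forall>j\<in>S. (A * Q) $$ (i, j) = 0"
    "\<forall>k<nr. \<forall>j<m. j \<notin> insert p S \<longrightarrow> (A * Q) $$ (k, j) = A $$ (k, j)"
    "\<forall>k<nr. (\<forall>j\<in>insert p S. A $$ (k, j) = 0) \<longrightarrow> (\<forall>j\<in>insert p S. (A * Q) $$ (k, j) = 0)"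
    by auto
  define B where "B = A * Q"
  note Q = Q[folded B_def]
  have B: "B \<in> carrier_mat nr m" using A GL_carrier[OF Q(1)] by (auto simp: B_def)
  have l: "l < m" "l \<noteq> p" "l \<notin> S" using insert by auto
  obtain d x y a b where d: "B $$ (i, p) = d * a" "B $$ (i, l) = d * b"
      "d = B $$ (i, p) * x + B $$ (i, l) * y"
    by (rule right_bezout_gcd[OF bez, of "B $$ (i, p)" "B $$ (i, l)"])
  show ?case
  proof (cases "d = 0")
    case True
    show ?thesis
    proof (intro bexI[OF _ Q(1)] conjI; fold B_def)
      show "\<forall>j\<in>insert l S. B $$ (i, j) = 0" using Q(2) d(2) True by auto
      show "\<forall>k<nr. \<forall>j<m. j \<notin> insert p (insert l S) \<longrightarrow> B $$ (k, j) = A $$ (k, j)" using Q(3) by auto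
      show "\<forall>k<nr. (\<forall>j\<in>insert p (insert l S). A $$ (k, j) = 0) \<longrightarrow>
        (\<forall>j\<in>insert p (insert l S). B $$ (k, j) = 0)" using Q(3,4) l by auto
    qed
  next
    case False
    have "d * (a * x + b * y) = B $$ (i, p) * x + B $$ (i, l) * y"
      unfolding d(1,2) by (simp add: algebra_simps)
    then have "d * (a * x + b * y) = d * 1" by (simp flip: d(3))
    then have one: "a * x + b * y = 1" using False mult_left_cancel by blast
    obtain g h r s where gh: "a * g + b * h = 0" "r * x + s * y = 0" "r * g + s * h = 1"
        "x * a + g * r = 1" "x * b + g * s = 0" "y * a + h * r = 0" "y * b + h * s = 1"
      by (rule unimodular_pair_completion[OF bez one])
    define E where "E = plane_mat m p l x g y h"
    have E: "E \<in> GL m" unfolding E_def using plane_mat_GL[of p m l] gh one l \<open>p < m\<close> by metis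
    have eq: "A * (Q * E) = B * E"
      using A GL_carrier[OF Q(1)] GL_carrier[OF E] by (simp add: B_def)
    have ix: "(B * E) $$ (k, j) = (if j = p then B $$ (k, p) * x + B $$ (k, l) * y
       else if j = l then B $$ (k, p) * g + B $$ (k, l) * h else B $$ (k, j))"
      if "k < nr" "j < m" for k j
      unfolding E_def using index_mult_plane_mat[OF B that \<open>p < m\<close> l(1)] l by auto
    have "d * a * g + d * b * h = d * (a * g + b * h)" by (simp add: algebra_simps)
    then have zero: "d * a * g + d * b * h = 0" by (simp add: gh)
    show ?thesis
    proof (intro bexI[OF _ GL_mult[OF Q(1) E]] conjI; unfold eq)
      show "\<forall>j\<in>insert l S. (B * E) $$ (i, j) = 0"
        using Q(2) d(1,2) l zero ix[OF \<open>i < nr\<close>] insert.prems by (auto simp: subset_eq)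
      show "\<forall>k<nr. \<forall>j<m. j \<notin> insert p (insert l S) \<longrightarrow> (B * E) $$ (k, j) = A $$ (k, j)"
        using Q(3) ix by auto
      show "\<forall>k<nr. (\<forall>j\<in>insert p (insert l S). A $$ (k, j) = 0) \<longrightarrow>
        (\<forall>j\<in>insert p (insert l S). (B * E) $$ (k, j) = 0)"
      proof (intro allI impI ballI)
        fix k j assume k: "k < nr" "\<forall>j\<in>insert p (insert l S). A $$ (k, j) = 0"
          and j: "j \<in> insert p (insert l S)"
        have "\<forall>j\<in>insert p (insert l S). B $$ (k, j) = 0" using Q(3,4) k l by auto
        moreover have "j < m" using j insert.prems \<open>p < m\<close> by auto
        ultimately show "(B * E) $$ (k, j) = 0" using ix[OF k(1)] j by auto
      qed
    qed
  qed
qed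

lemma lower_triangularization:
  fixes A :: "'a::ring_1_no_zero_divisors mat"
  assumes bez: "right_bezout_ring TYPE('a)" and A: "A \<in> carrier_mat m m"
  shows "\<exists>Q\<in>GL m. lower_triangular (A * Q)"
proof -
  have "\<exists>Q\<in>GL m. \<forall>i<k. \<forall>j<m. i < j \<longrightarrow> (A * Q) $$ (i, j) = 0" if "k \<le> m" for k
    using that
  proof (induction k)
    case 0
    show ?case using one_GL by auto
  next
    case (Suc k)
    then obtain Q where Q: "Q \<in> GL m" "\<forall>i<k. \<forall>j<m. i < j \<longrightarrow> (A * Q) $$ (i, j) = 0" by auto
    have AQ: "A * Q \<in> carrier_mat m m" using A GL_carrier[OF Q(1)] by auto
    obtain Q' where Q': "Q' \<in> GL m" "\<forall>j\<in>{k<..<m}. (A * Q * Q') $$ (k, j) = 0"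
      "\<forall>i<m. \<forall>j<m. j \<notin> insert k {k<..<m} \<longrightarrow> (A * Q * Q') $$ (i, j) = (A * Q) $$ (i, j)"
      "\<forall>i<m. (\<forall>j\<in>insert k {k<..<m}. (A * Q) $$ (i, j) = 0) \<longrightarrow>
        (\<forall>j\<in>insert k {k<..<m}. (A * Q * Q') $$ (i, j) = 0)"
    proof -
      have "k < m" "finite {k<..<m}" "{k<..<m} \<subseteq> {..<m}" "k \<notin> {k<..<m}"
        using Suc.prems by auto
      from row_reduction[OF bez AQ this(1,1) this(2-4)] that show thesis by blast
    qed
    have eq: "A * Q * Q' = A * (Q * Q')" using A GL_carrier[OF Q(1)] GL_carrier[OF Q'(1)] by auto
    show ?case
    proof (intro bexI[OF _ GL_mult[OF Q(1) Q'(1)]] allI impI; fold eq)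
      fix i j assume ij: "i < Suc k" "j < m" "i < j"
      show "(A * Q * Q') $$ (i, j) = 0"
      proof (cases "i = k")
        case True
        then show ?thesis using Q'(2) ij by auto
      next
        case False
        then have i: "i < k" "i < m" using ij Suc.prems by auto
        show ?thesis
        proof (cases "j < k")
          case True
          then show ?thesis using Q'(3) Q(2) i ij by simp
        next
          case False
          have "\<forall>j\<in>insert k {k<..<m}. (A * Q) $$ (i, j) = 0" using Q(2) i(1) Suc.prems by simp
          with Q'(4) i(2) have "\<forall>j\<in>insert k {k<..<m}. (A * Q * Q') $$ (i, j) = 0" by blast
          then show ?thesis using False ij by auto
        qed
      qed
    qed
  qed
  then obtain Q where "Q \<in> GL m" "\<forall>i<m. \<forall>j<m. i < j \<longrightarrow> (A * Q) $$ (i, j) = 0" by blast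
  moreover have "dim_col (A * Q) = m" using GL_carrier[OF \<open>Q \<in> GL m\<close>] by auto
  ultimately show ?thesis unfolding lower_triangular_def by (intro bexI[of _ Q]) auto
qed

section \<open>Equivalence of matrices\<close>

definition equivalent :: "nat \<Rightarrow> 'a::ring_1 mat \<Rightarrow> 'a mat \<Rightarrow> bool" where
  "equivalent m A B \<longleftrightarrow> (\<exists>P\<in>GL m. \<exists>Q\<in>GL m. P * A * Q = B)"

abbreviation dsum :: "'a::zero mat \<Rightarrow> 'a mat \<Rightarrow> 'a mat" where
  "dsum A B \<equiv> four_block_mat A (0\<^sub>m (dim_row A) (dim_col B)) (0\<^sub>m (dim_row B) (dim_col A)) B"

lemma equivalentI: "P \<in> GL m \<Longrightarrow> Q \<in> GL m \<Longrightarrow> equivalent m A (P * A * Q)"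
  by (auto simp: equivalent_def)

lemma equivalent_refl: "A \<in> carrier_mat m m \<Longrightarrow> equivalent m A A"
  unfolding equivalent_def by (auto intro!: bexI[OF _ one_GL])

lemma equivalent_trans:
  assumes "A \<in> carrier_mat m m" "equivalent m A B" "equivalent m B C"
  shows "equivalent m A C"
proof -
  obtain P Q P' Q' where PQ: "P \<in> GL m" "Q \<in> GL m" "P * A * Q = B"
      "P' \<in> GL m" "Q' \<in> GL m" "P' * B * Q' = C"
    using assms unfolding equivalent_def by blast
  have "(P' * P) * A * (Q * Q') = C"
    using PQ(3,6) assms(1) PQ(1,2,4,5)[THEN GL_carrier]
    by (auto simp: assoc_mult_mat[of _ m m _ m _ m])
  then show ?thesis using GL_mult PQ unfolding equivalent_def by blast
qed

lemma dsum_mult: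
  fixes A A' B B' :: "'a::ring_1 mat"
  assumes "A \<in> carrier_mat a a" "A' \<in> carrier_mat a a" "B \<in> carrier_mat b b" "B' \<in> carrier_mat b b"
  shows "dsum A B * dsum A' B' = dsum (A * A') (B * B')"
  using assms by (subst mult_four_block_mat[of _ a a _ b _ b _ _ a _ b]) auto

lemma dsum_GL:
  assumes "P \<in> GL a" "Q \<in> GL b"
  shows "dsum P Q \<in> GL (a + b)"
proof -
  obtain P' Q' where inv: "P' \<in> GL a" "P * P' = 1\<^sub>m a" "P' * P = 1\<^sub>m a"
      "Q' \<in> GL b" "Q * Q' = 1\<^sub>m b" "Q' * Q = 1\<^sub>m b"
    using GL_inverse assms by metis
  note c = GL_carrier[OF assms(1)] GL_carrier[OF assms(2)] GL_carrier[OF inv(1)] GL_carrier[OF inv(4)]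
  show ?thesis unfolding GL_iff
  proof (intro conjI bexI[of _ "dsum P' Q'"])
    show "dsum P Q * dsum P' Q' = 1\<^sub>m (a + b)"
      unfolding dsum_mult[OF c(1,3) c(2,4)] using inv by simp
    show "dsum P' Q' * dsum P Q = 1\<^sub>m (a + b)"
      unfolding dsum_mult[OF c(3,1) c(4,2)] using inv by simp
  qed (use c in auto)
qed

lemma equivalent_dsum:
  assumes "A \<in> carrier_mat a a" "B \<in> carrier_mat b b" "equivalent a A A'" "equivalent b B B'"
  shows "equivalent (a + b) (dsum A B) (dsum A' B')"
proof -
  obtain P Q P' Q' where PQ: "P \<in> GL a" "Q \<in> GL a" "P * A * Q = A'"
      "P' \<in> GL b" "Q' \<in> GL b" "P' * B * Q' = B'"
    using assms unfolding equivalent_def by blast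
  note c = PQ(1,2,4,5)[THEN GL_carrier]
  have c': "P * A \<in> carrier_mat a a" "P' * B \<in> carrier_mat b b" using c assms(1,2) by auto
  have "dsum P P' * dsum A B * dsum Q Q' = dsum A' B'"
    unfolding dsum_mult[OF c(1) assms(1) c(3) assms(2)] dsum_mult[OF c'(1) c(2) c'(2) c(4)] PQ(3,6) ..
  then show ?thesis using dsum_GL PQ unfolding equivalent_def by blast
qed

section \<open>Splitting off a one-dimensional summand\<close>

lemma index_mult_mat_single:
  assumes "X \<in> carrier_mat nr k" "Y \<in> carrier_mat k nc" "i < nr" "j < nc" "p < k"
    and "\<And>l. l < k \<Longrightarrow> l \<noteq> p \<Longrightarrow> X $$ (i, l) = 0"
  shows "(X * Y) $$ (i, j) = X $$ (i, p) * Y $$ (p, j)"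
proof -
  have "(X * Y) $$ (i, j) = (\<Sum>l<k. X $$ (i, l) * Y $$ (l, j))"
    by (rule index_mult_mat_sum[OF assms(1-4)])
  also have "\<dots> = (\<Sum>l\<in>{p}. X $$ (i, l) * Y $$ (l, j))"
    using assms(5,6) by (intro sum.mono_neutral_right) auto
  finally show ?thesis by simp
qed

text \<open>If \<open>u Q = (0, \<dots>, 0, d)\<close>, then \<open>u A = 0\<close> says that \<open>d\<close> annihilates the last row of
  \<open>Q\<inverse> A\<close>. That row is zero because \<open>d \<noteq> 0\<close>; a lower triangular form obtained by column
  operations keeps it zero, so that its last column vanishes too.\<close>

lemma left_kernel_imp_zero_summand:
  fixes A :: "'a::ring_1_no_zero_divisors mat"
  assumes bez: "right_bezout_ring TYPE('a)" and A: "A \<in> carrier_mat (Suc m) (Suc m)"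
    and u: "u \<in> carrier_mat 1 (Suc m)" "u \<noteq> 0\<^sub>m 1 (Suc m)" "u * A = 0\<^sub>m 1 (Suc m)"
  shows "\<exists>A'\<in>carrier_mat m m. equivalent (Suc m) A (dsum A' (0\<^sub>m 1 1))"
proof -
  obtain Q where Q: "Q \<in> GL (Suc m)" "\<forall>j\<in>{..<m}. (u * Q) $$ (0, j) = 0"
  proof -
    have "(0::nat) < 1" "m < Suc m" "finite {..<m}" "{..<m} \<subseteq> {..<Suc m}" "m \<notin> {..<m}" by auto
    from row_reduction[OF bez u(1) this] that show thesis by blast
  qed
  obtain P where P: "P \<in> GL (Suc m)" "Q * P = 1\<^sub>m (Suc m)" using GL_inverse[OF Q(1)] by blast
  note c = GL_carrier[OF Q(1)] GL_carrier[OF P(1)]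
  have uQ: "u * Q \<in> carrier_mat 1 (Suc m)" and PA: "P * A \<in> carrier_mat (Suc m) (Suc m)"
    using u(1) A c by auto
  define d where "d = (u * Q) $$ (0, m)"
  have zero: "l < Suc m \<Longrightarrow> l \<noteq> m \<Longrightarrow> (u * Q) $$ (0, l) = 0" for l using Q(2) by simp
  have "d \<noteq> 0"
  proof
    assume "d = 0"
    then have "(u * Q) $$ (0, l) = 0" if "l < Suc m" for l
      using zero that by (cases "l = m") (auto simp: d_def)
    then have "u * Q = 0\<^sub>m 1 (Suc m)" using uQ by (intro eq_matI) (auto simp del: index_mult_mat(1))
    then have "u * Q * P = 0\<^sub>m 1 (Suc m)" using c by simp
    moreover have "u * Q * P = u" using u(1) c P(2) by (simp add: assoc_mult_mat[of u 1 "Suc m"])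
    ultimately show False using u(2) by simp
  qed
  have last: "(P * A) $$ (m, j) = 0" if j: "j < Suc m" for j
  proof -
    have "u * Q * (P * A) = u * (Q * (P * A))" by (rule assoc_mult_mat[OF u(1) c(1) PA])
    also have "Q * (P * A) = Q * P * A" using A c by simp
    also have "u * (Q * P * A) = 0\<^sub>m 1 (Suc m)" using P(2) A u(3) by simp
    finally have "(u * Q * (P * A)) $$ (0, j) = 0" using j by simp
    moreover have "(u * Q * (P * A)) $$ (0, j) = d * (P * A) $$ (m, j)"
      unfolding d_def using index_mult_mat_single[OF uQ PA _ j _ zero] by simp
    ultimately show ?thesis using \<open>d \<noteq> 0\<close> by simp
  qed
  obtain Q' where Q': "Q' \<in> GL (Suc m)" "lower_triangular (P * A * Q')"
    using lower_triangularization[OF bez PA] by blast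
  define C where "C = P * A * Q'"
  have C: "C \<in> carrier_mat (Suc m) (Suc m)" using PA GL_carrier[OF Q'(1)] by (simp add: C_def)
  have row0: "C $$ (m, j) = 0" if "j < Suc m" for j
    unfolding C_def using index_mult_mat_sum[OF PA GL_carrier[OF Q'(1)] _ that] last by simp
  have col0: "C $$ (i, m) = 0" if "i < m" for i
    using Q'(2) that C unfolding lower_triangular_def C_def[symmetric] by auto
  have "C = dsum (mat m m (\<lambda>ij. C $$ ij)) (0\<^sub>m 1 1)"
  proof (rule eq_matI)
    fix i j
    assume "i < dim_row (dsum (mat m m (\<lambda>ij. C $$ ij)) (0\<^sub>m 1 1))"
      "j < dim_col (dsum (mat m m (\<lambda>ij. C $$ ij)) (0\<^sub>m 1 1))"
    then have "i < Suc m" "j < Suc m" by auto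
    then show "C $$ (i, j) = dsum (mat m m (\<lambda>ij. C $$ ij)) (0\<^sub>m 1 1) $$ (i, j)"
      using row0 col0 by (cases "i = m"; cases "j = m") auto
  qed (use C in auto)
  moreover have "equivalent (Suc m) A C"
    unfolding C_def using P(1) Q'(1) by (rule equivalentI)
  ultimately show ?thesis by (intro bexI[of _ "mat m m (\<lambda>ij. C $$ ij)"]) auto
qed

text \<open>The row \<open>u\<close> is unimodular, so in a suitable basis \<open>u\<close> is a unit multiple of the first
  basis row. The first row of the transformed matrix takes a unit value as well, hence it is
  unimodular and column operations bring it to \<open>(c, 0, \<dots>, 0)\<close> with a unit \<open>c\<close>. Row operations
  then normalise \<open>c\<close> to \<open>1\<close> and clear the first column.\<close>

lemma unit_value_imp_one_summand:
  fixes A :: "'a::ring_1_no_zero_divisors mat"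
  assumes bez: "right_bezout_ring TYPE('a)" and A: "A \<in> carrier_mat (Suc m) (Suc m)"
    and u: "u \<in> carrier_mat 1 (Suc m)" and w: "w \<in> carrier_mat (Suc m) 1"
    and one: "u * A * w = 1\<^sub>m 1"
  shows "\<exists>A'\<in>carrier_mat m m. equivalent (Suc m) A (dsum (1\<^sub>m 1) A')"
proof -
  have S: "finite {1..<Suc m}" "{1..<Suc m} \<subseteq> {..<Suc m}" "0 \<notin> {1..<Suc m}" by auto
  obtain Q where Q: "Q \<in> GL (Suc m)" "\<forall>j\<in>{1..<Suc m}. (u * Q) $$ (0, j) = 0"
    using row_reduction[OF bez u _ _ S, of 0] by auto
  obtain P where P: "P \<in> GL (Suc m)" "Q * P = 1\<^sub>m (Suc m)" using GL_inverse[OF Q(1)] by blast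
  note c = GL_carrier[OF Q(1)] GL_carrier[OF P(1)]
  have uQ: "u * Q \<in> carrier_mat 1 (Suc m)" and PA: "P * A \<in> carrier_mat (Suc m) (Suc m)"
    using u A c by auto
  have PAw: "P * A * w \<in> carrier_mat (Suc m) 1" using PA w by auto
  have Aw: "A * w \<in> carrier_mat (Suc m) 1" using A w by simp
  have "Q * (P * A * w) = Q * (P * (A * w))" unfolding assoc_mult_mat[OF c(2) A w] ..
  also have "\<dots> = Q * P * (A * w)" by (rule assoc_mult_mat[symmetric, OF c(1,2) Aw])
  also have "\<dots> = A * w" unfolding P(2) by (rule left_mult_one_mat[OF Aw])
  finally have "u * Q * (P * A * w) = 1\<^sub>m 1"
    using assoc_mult_mat[OF u c(1) PAw] assoc_mult_mat[OF u A w] one by metis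
  then have "(u * Q * (P * A * w)) $$ (0, 0) = 1" by (metis index_one_mat(1) less_one)
  moreover have "(u * Q * (P * A * w)) $$ (0, 0) = (u * Q) $$ (0, 0) * (P * A * w) $$ (0, 0)"
    using Q(2) by (intro index_mult_mat_single[OF uQ PAw]) auto
  ultimately have d: "(P * A * w) $$ (0, 0) * (u * Q) $$ (0, 0) = 1"
    using right_inverse_imp_left_inverse by metis
  obtain Q' where Q': "Q' \<in> GL (Suc m)" "\<forall>j\<in>{1..<Suc m}. (P * A * Q') $$ (0, j) = 0"
    using row_reduction[OF bez PA _ _ S, of 0] by auto
  obtain P' where P': "P' \<in> GL (Suc m)" "Q' * P' = 1\<^sub>m (Suc m)" using GL_inverse[OF Q'(1)] by blast
  note c' = GL_carrier[OF Q'(1)] GL_carrier[OF P'(1)]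
  define C where "C = P * A * Q'"
  have C: "C \<in> carrier_mat (Suc m) (Suc m)" using PA c' by (simp add: C_def)
  have P'w: "P' * w \<in> carrier_mat (Suc m) 1" using c' w by auto
  have "C * (P' * w) = P * A * (Q' * (P' * w))"
    unfolding C_def by (rule assoc_mult_mat[OF PA c'(1) P'w])
  also have "Q' * (P' * w) = w"
    using assoc_mult_mat[OF c' w] left_mult_one_mat[OF w] P'(2) by simp
  finally have "P * A * w = C * (P' * w)" ..
  moreover have "(C * (P' * w)) $$ (0, 0) = C $$ (0, 0) * (P' * w) $$ (0, 0)"
    using Q'(2) by (intro index_mult_mat_single[OF C P'w]) (auto simp: C_def)
  ultimately have "C $$ (0, 0) * ((P' * w) $$ (0, 0) * (u * Q) $$ (0, 0)) = 1"
    using d by (simp only: mult.assoc)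
  then obtain e where e: "C $$ (0, 0) * e = 1" by blast
  then have e': "e * C $$ (0, 0) = 1" by (rule right_inverse_imp_left_inverse)
  obtain C1 C2 C3 C4 where split: "split_block C 1 1 = (C1, C2, C3, C4)" by (metis prod_cases4)
  have dims: "dim_row C = 1 + m" "dim_col C = 1 + m" using C by auto
  note blocks = split_block[OF split dims]
  define E where "E = mat 1 1 (\<lambda>_. e)"
  have E: "E \<in> carrier_mat 1 1" by (simp add: E_def)
  have C1: "C1 $$ (0, 0) = C $$ (0, 0)" using split by (auto simp: split_block_def Let_def)
  have EC: "E * C1 = 1\<^sub>m 1" "C1 * E = 1\<^sub>m 1"
    using E blocks(1) e e' by (auto intro!: eq_matI simp: scalar_prod_def E_def C1)
  have "C2 $$ (0, j) = 0" if "j < m" for j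
    using split Q'(2) that by (auto simp: split_block_def Let_def dims simp flip: C_def)
  then have C2: "C2 = 0\<^sub>m 1 m" using blocks(2) by (intro eq_matI) auto
  \<comment> \<open>\<open>L\<close> scales the first row by the inverse of its unit entry and subtracts multiples of it
    from the rows below; replacing \<open>E\<close> by \<open>C1\<close> and \<open>F\<close> by \<open>C3\<close> undoes this.\<close>
  define F where "F = - (C3 * E)"
  have F: "F \<in> carrier_mat m 1" using blocks(3) E by (simp add: F_def)
  have FC: "F * C1 + C3 = 0\<^sub>m m 1"
  proof -
    have "F * C1 = - (C3 * E * C1)"
      unfolding F_def using E blocks(1) by (intro uminus_mult_left_mat) auto
    also have "C3 * E * C1 = C3" using blocks(1,3) E EC by simp
    finally show ?thesis using blocks(3) by simp
  qed
  have CF: "C3 * E + F = 0\<^sub>m m 1"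
    unfolding F_def using blocks(3) E by (intro eq_matI) (auto simp del: index_mult_mat(1))
  define L where "L = four_block_mat E (0\<^sub>m 1 m) F (1\<^sub>m m)"
  define L' where "L' = four_block_mat C1 (0\<^sub>m 1 m) C3 (1\<^sub>m m)"
  have "L * L' = 1\<^sub>m (1 + m)" "L' * L = 1\<^sub>m (1 + m)"
    unfolding L_def L'_def using E F blocks(1,3) EC FC CF
      four_block_one_mat[where ?n1.0 = 1 and ?n2.0 = m and ?'a = 'a]
    by (subst mult_four_block_mat[of _ 1 1 _ m _ m _ _ 1 _ m]; simp)+
  moreover have "L \<in> carrier_mat (1 + m) (1 + m)" "L' \<in> carrier_mat (1 + m) (1 + m)"
    unfolding L_def L'_def using E F blocks(1) by (intro four_block_carrier_mat; simp)+
  ultimately have L: "L \<in> GL (Suc m)" unfolding GL_iff by (auto intro!: bexI[of _ L'])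
  have "L * C = dsum (1\<^sub>m 1) C4"
    unfolding blocks(5) L_def C2 using E F blocks EC FC
    by (subst mult_four_block_mat[of _ 1 1 _ m _ m _ _ 1 _ m]) simp_all
  moreover have "L * C = L * P * A * Q'"
    unfolding C_def assoc_mult_mat[OF GL_carrier[OF L] c(2) A]
    by (rule assoc_mult_mat[symmetric, OF GL_carrier[OF L] PA c'(1)])
  ultimately have "equivalent (Suc m) A (dsum (1\<^sub>m 1) C4)"
    using equivalentI[OF GL_mult[OF L P(1)] Q'(1), of A] by simp
  then show ?thesis using blocks(4) by blast
qed

text \<open>Adding the \<open>k\<close>-th unit row to the \<open>m\<close> rows of \<open>A\<close> produces a dependence, in which the unit
  row has a nonzero coefficient because \<open>A\<close> is regular. Some nonzero left multiple of every
  unit row is thus a combination of rows of \<open>A\<close>, and a common left multiple \<open>d\<close> of the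
  coefficients serves for all \<open>k\<close> at once. Representing \<open>1\<close> as a sum of \<open>n \<le> m\<close> terms
  \<open>a\<^sub>i d v\<^sub>i\<close> then gives \<open>u\<close> and \<open>w\<close>.\<close>

lemma unit_value_of_left_regular:
  fixes A :: "'a::ring_1_no_zero_divisors mat"
  assumes bez: "left_bezout_ring TYPE('a)" and sum: "one_as_sum TYPE('a) n" and "n \<le> m"
    and A: "A \<in> carrier_mat m m"
    and regular: "\<And>u. u \<in> carrier_mat 1 m \<Longrightarrow> u * A = 0\<^sub>m 1 m \<Longrightarrow> u = 0\<^sub>m 1 m"
  obtains u w where "u \<in> carrier_mat 1 m" "w \<in> carrier_mat m 1" "u * A * w = 1\<^sub>m 1"
proof -
  define R where "R k x t \<longleftrightarrow> t \<noteq> 0 \<and>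
    (\<forall>j<m. (\<Sum>i<m. x i * A $$ (i, j)) = (if j = k then t else 0))" for k t and x :: "nat \<Rightarrow> 'a"
  have "\<exists>x t. R k x t" for k
  proof -
    \<comment> \<open>The index \<open>m\<close> stands for the additional unit row.\<close>
    let ?f = "\<lambda>i j. if i < m then A $$ (i, j) else if j = k then 1 else 0"
    obtain x where x: "\<exists>i\<in>{..m}. x i \<noteq> 0" "\<forall>j\<in>{..<m}. (\<Sum>i\<le>m. x i * ?f i j) = 0"
      using left_dependence[OF bez, of "{..<m}" "{..m}" ?f] by auto
    have split: "(\<Sum>i\<le>m. x i * ?f i j) = (\<Sum>i<m. x i * A $$ (i, j)) + (if j = k then x m else 0)" for j
      by (simp flip: lessThan_Suc_atMost)
    have eq: "(\<Sum>i<m. x i * A $$ (i, j)) = (if j = k then - x m else 0)" if "j < m" for j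
      using x(2) that split[of j] by (auto simp: eq_neg_iff_add_eq_0)
    have "x m \<noteq> 0"
    proof
      assume "x m = 0"
      let ?u = "mat 1 m (\<lambda>(_, i). x i)"
      have "(?u * A) $$ (0, j) = 0" if "j < m" for j
        using index_mult_mat_sum[of ?u 1 m A m 0 j] A that eq[OF that] \<open>x m = 0\<close> by simp
      then have "?u * A = 0\<^sub>m 1 m" using A by (intro eq_matI) (auto simp del: index_mult_mat(1))
      then have "?u = 0\<^sub>m 1 m" by (rule regular[rotated]) simp
      then have "?u $$ (0, i) = 0" if "i < m" for i using that by simp
      then have "x i = 0" if "i < m" for i using that by simp
      then show False using x(1) \<open>x m = 0\<close> by (metis atMost_iff le_neq_implies_less)
    qed
    then have "R k x (- x m)" using eq by (simp add: R_def)
    then show ?thesis by blast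
  qed
  then obtain x t where "\<And>k. R k (x k) (t k)" by metis
  then have xt: "\<And>k. t k \<noteq> 0"
    "\<And>k j. j < m \<Longrightarrow> (\<Sum>i<m. x k i * A $$ (i, j)) = (if j = k then t k else 0)"
    by (simp_all add: R_def)
  obtain d b where d: "d \<noteq> 0" "\<And>k. k < m \<Longrightarrow> d = b k * t k"
    using common_left_multiple[OF bez, of "{..<m}" t] xt(1) by auto
  obtain a v where av: "(\<Sum>i<n. a i * d * v i) = 1"
    using sum d(1) unfolding one_as_sum_def by blast
  define u where "u = mat 1 m (\<lambda>(_, i). \<Sum>k<n. a k * (b k * x k i))"
  define w where "w = mat m 1 (\<lambda>(j, _). if j < n then v j else 0)"
  have u: "u \<in> carrier_mat 1 m" and w: "w \<in> carrier_mat m 1" by (auto simp: u_def w_def)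
  have uA: "(u * A) $$ (0, j) = (if j < n then a j * d else 0)" if j: "j < m" for j
  proof -
    have "(u * A) $$ (0, j) = (\<Sum>i<m. u $$ (0, i) * A $$ (i, j))"
      using index_mult_mat_sum[OF u A _ j] by simp
    also have "\<dots> = (\<Sum>i<m. \<Sum>k<n. a k * (b k * (x k i * A $$ (i, j))))"
      by (simp add: u_def sum_distrib_right mult.assoc)
    also have "\<dots> = (\<Sum>k<n. a k * (b k * (\<Sum>i<m. x k i * A $$ (i, j))))"
      by (subst sum.swap) (simp add: sum_distrib_left)
    also have "\<dots> = (\<Sum>k<n. if k = j then a j * (b j * t j) else 0)"
      by (rule sum.cong) (auto simp: xt(2)[OF j])
    also have "\<dots> = (if j < n then a j * d else 0)"
      using d(2)[OF j] by simp
    finally show ?thesis .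
  qed
  have "(u * A * w) $$ (0, 0) = (\<Sum>j<m. (u * A) $$ (0, j) * w $$ (j, 0))"
    using index_mult_mat_sum[of "u * A" 1 m w 1 0 0] u A w by auto
  also have "\<dots> = (\<Sum>j<m. if j < n then a j * d * v j else 0)"
    by (rule sum.cong) (auto simp: uA w_def simp del: index_mult_mat(1))
  also have "\<dots> = (\<Sum>j<n. a j * d * v j)"
    using \<open>n \<le> m\<close> by (intro sum.mono_neutral_cong_right) auto
  finally have "u * A * w = 1\<^sub>m 1"
    using u A w av by (intro eq_matI) (auto simp del: index_mult_mat(1))
  then show ?thesis using that u w by blast
qed

section \<open>The normal form\<close>

lemma equivalent_one_triangular_zero:
  fixes A :: "'a::ring_1_no_zero_divisors mat"
  assumes right: "right_bezout_ring TYPE('a)" and left: "left_bezout_ring TYPE('a)"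
    and sum: "one_as_sum TYPE('a) n" and "n \<le> m" "A \<in> carrier_mat m m"
  shows "\<exists>r s. \<exists>T\<in>carrier_mat n n. lower_triangular T \<and> r + n + s = m \<and>
    equivalent m A (dsum (1\<^sub>m r) (dsum T (0\<^sub>m s s)))"
  using assms(4,5)
proof (induction m arbitrary: A rule: nat_induct_at_least)
  case base
  obtain Q where Q: "Q \<in> GL n" "lower_triangular (A * Q)"
    using lower_triangularization[OF right base] by blast
  have AQ: "A * Q \<in> carrier_mat n n" using base GL_carrier[OF Q(1)] by auto
  have "dsum (1\<^sub>m 0) (dsum (A * Q) (0\<^sub>m 0 0)) = 1\<^sub>m n * A * Q"
    using base AQ by (intro eq_matI) (auto simp del: index_mult_mat(1))
  then have "equivalent n A (dsum (1\<^sub>m 0) (dsum (A * Q) (0\<^sub>m 0 0)))"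
    using equivalentI[OF one_GL Q(1)] by simp
  then show ?case using Q AQ by (intro exI[of _ 0] bexI[of _ "A * Q"]) auto
next
  case (Suc m)
  show ?case
  proof (cases "\<exists>u\<in>carrier_mat 1 (Suc m). u \<noteq> 0\<^sub>m 1 (Suc m) \<and> u * A = 0\<^sub>m 1 (Suc m)")
    case True
    then obtain A' where A': "A' \<in> carrier_mat m m" "equivalent (Suc m) A (dsum A' (0\<^sub>m 1 1))"
      using left_kernel_imp_zero_summand[OF right Suc.prems] by blast
    obtain r s T where T: "T \<in> carrier_mat n n" "lower_triangular T" "r + n + s = m"
      "equivalent m A' (dsum (1\<^sub>m r) (dsum T (0\<^sub>m s s)))" using Suc.IH[OF A'(1)] by blast
    have "equivalent (m + 1) (dsum A' (0\<^sub>m 1 1)) (dsum (dsum (1\<^sub>m r) (dsum T (0\<^sub>m s s))) (0\<^sub>m 1 1))"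
      using A'(1) T(4) by (intro equivalent_dsum equivalent_refl) auto
    also have "dsum (dsum (1\<^sub>m r) (dsum T (0\<^sub>m s s))) (0\<^sub>m 1 1)
        = dsum (1\<^sub>m r) (dsum T (dsum (0\<^sub>m s s) (0\<^sub>m 1 1)))"
      by (simp only: assoc_four_block_mat)
    also have "dsum (0\<^sub>m s s) (0\<^sub>m 1 1) = 0\<^sub>m (s + 1) (s + 1)" by simp
    finally have "equivalent (Suc m) A (dsum (1\<^sub>m r) (dsum T (0\<^sub>m (s + 1) (s + 1))))"
      using equivalent_trans[OF Suc.prems A'(2)] by simp
    moreover have "r + n + (s + 1) = Suc m" using T(3) by simp
    ultimately show ?thesis using T(1,2) by blast
  next
    case False
    have "n \<le> Suc m" using Suc.hyps by simp
    then obtain u w where uw: "u \<in> carrier_mat 1 (Suc m)" "w \<in> carrier_mat (Suc m) 1"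
        "u * A * w = 1\<^sub>m 1"
      using unit_value_of_left_regular[OF left sum _ Suc.prems] False by blast
    then obtain A' where A': "A' \<in> carrier_mat m m" "equivalent (Suc m) A (dsum (1\<^sub>m 1) A')"
      using unit_value_imp_one_summand[OF right Suc.prems uw] by blast
    obtain r s T where T: "T \<in> carrier_mat n n" "lower_triangular T" "r + n + s = m"
      "equivalent m A' (dsum (1\<^sub>m r) (dsum T (0\<^sub>m s s)))" using Suc.IH[OF A'(1)] by blast
    have "equivalent (1 + m) (dsum (1\<^sub>m 1) A') (dsum (1\<^sub>m 1) (dsum (1\<^sub>m r) (dsum T (0\<^sub>m s s))))"
      using A'(1) T(4) by (intro equivalent_dsum equivalent_refl) auto
    also have "dsum (1\<^sub>m 1) (dsum (1\<^sub>m r) (dsum T (0\<^sub>m s s)))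
        = dsum (dsum (1\<^sub>m 1) (1\<^sub>m r)) (dsum T (0\<^sub>m s s))"
      by (simp only: assoc_four_block_mat)
    also have "dsum (1\<^sub>m 1) (1\<^sub>m r) = 1\<^sub>m (1 + r)" by simp
    finally have "equivalent (Suc m) A (dsum (1\<^sub>m (1 + r)) (dsum T (0\<^sub>m s s)))"
      using equivalent_trans[OF Suc.prems A'(2)] by simp
    moreover have "1 + r + n + s = Suc m" using T(3) by simp
    ultimately show ?thesis using T(1,2) by blast
  qed
qed

theorem theorem4:
  fixes n m :: nat and A :: "'a::ring_1_no_zero_divisors mat"
  assumes "n \<ge> 1"
    and "bezout_domain TYPE('a)"
    and "n_simple_ring TYPE('a) n"
    and "m \<ge> n"
    and "A \<in> carrier_mat m m"
  shows "\<exists>P Q :: 'a mat. P \<in> GL m \<and> Q \<in> GL m \<and>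
    (\<exists>r s. \<exists>As :: 'a mat list.
      (\<forall>B \<in> set As. B \<in> carrier_mat n n \<and> triangular B) \<and>
      r + length As * n + s = m \<and>
      P * A * Q = diag_block_mat [1\<^sub>m r, diag_block_mat As, 0\<^sub>m s s])"
proof -
  have bez: "right_bezout_ring TYPE('a)" "left_bezout_ring TYPE('a)"
    using assms(2) by (auto simp: bezout_domain_def bezout_ring_def)
  have "one_as_sum TYPE('a) n" using assms(3) by (simp add: n_simple_ring_def)
  from equivalent_one_triangular_zero[OF bez this assms(4,5)]
  obtain r s T where T: "T \<in> carrier_mat n n" "lower_triangular T" "r + n + s = m"
    "equivalent m A (dsum (1\<^sub>m r) (dsum T (0\<^sub>m s s)))" by blast
  have "diag_block_mat [1\<^sub>m r, diag_block_mat [T], 0\<^sub>m s s] = dsum (1\<^sub>m r) (dsum T (0\<^sub>m s s))"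
    by (simp only: diag_block_mat_singleton diag_block_mat.simps(2)[of _ "[_, _]"]
      diag_block_mat.simps(2)[of _ "[_]"] Let_def)
  then obtain P Q where PQ: "P \<in> GL m" "Q \<in> GL m"
    "P * A * Q = diag_block_mat [1\<^sub>m r, diag_block_mat [T], 0\<^sub>m s s]"
    using T(4) unfolding equivalent_def by metis
  have "triangular T" using T(1,2) by (auto simp: triangular_def)
  then show ?thesis using T(1,3) PQ
    by (intro exI[of _ P] exI[of _ Q] exI[of _ r] exI[of _ s] exI[of _ "[T]"] conjI) auto
qed

end
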